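(* Let $G=(V,E)$ be a finite simple undirected graph. With the notation of the context (non-induced counts $|M_a^{(5)}|$ and induced counts $|\widetilde{M}_a^{(5)}|$), the following hold: $|\widetilde{M}_{75}^{(5)}| = |M_{75}^{(5)}| - |M_{79}^{(5)}| + |M_{95}^{(5)}| - |M_{127}^{(5)}| - 2 |M_{223}^{(5)}| + |M_{235}^{(5)}| - |M_{239}^{(5)}| + 2 |M_{255}^{(5)}| + |M_{507}^{(5)}| - 3 |M_{511}^{(5)}| + 5 |M_{1023}^{(5)}|$; $|\widetilde{M}_{77}^{(5)}| = |M_{77}^{(5)}| - 2 |M_{79}^{(5)}| - 2 |M_{87}^{(5)}| - 2 |M_{94}^{(5)}| + 5 |M_{95}^{(5)}| - |M_{117}^{(5)}| + 4 |M_{119}^{(5)}| - 9 |M_{127}^{(5)}| + 6 |M_{222}^{(5)}| - 12 |M_{223}^{(5)}| + 4 |M_{235}^{(5)}| + 4 |M_{237}^{(5)}| - 10 |M_{239}^{(5)}| - 10 |M_{254}^{(5)}| + 20 |M_{255}^{(5)}| + 20 |M_{507}^{(5)}| - 36 |M_{511}^{(5)}| + 60 |M_{1023}^{(5)}|$; $|\widetilde{M}_{79}^{(5)}| = |M_{79}^{(5)}| - 2 |M_{95}^{(5)}| + 3 |M_{127}^{(5)}| + 6 |M_{223}^{(5)}| - 2 |M_{235}^{(5)}| + 3 |M_{239}^{(5)}| - 8 |M_{255}^{(5)}| - 4 |M_{507}^{(5)}| + 15 |M_{511}^{(5)}| - 30 |M_{1023}^{(5)}|$; $|\widetilde{M}_{86}^{(5)}|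 = |M_{86}^{(5)}| - |M_{87}^{(5)}| - 2 |M_{94}^{(5)}| + 2 |M_{95}^{(5)}| - 2 |M_{117}^{(5)}| + 4 |M_{119}^{(5)}| - 6 |M_{127}^{(5)}| + 6 |M_{222}^{(5)}| - 6 |M_{223}^{(5)}| + 4 |M_{235}^{(5)}| - 5 |M_{236}^{(5)}| + 7 |M_{237}^{(5)}| - 10 |M_{239}^{(5)}| - 14 |M_{254}^{(5)}| + 18 |M_{255}^{(5)}| + 24 |M_{507}^{(5)}| - 36 |M_{511}^{(5)}| + 60 |M_{1023}^{(5)}|$; $|\widetilde{M}_{87}^{(5)}| = |M_{87}^{(5)}| - 2 |M_{95}^{(5)}| - 2 |M_{119}^{(5)}| + 6 |M_{127}^{(5)}| + 6 |M_{223}^{(5)}| - |M_{237}^{(5)}| + 5 |M_{239}^{(5)}| + 4 |M_{254}^{(5)}| - 14 |M_{255}^{(5)}| - 12 |M_{507}^{(5)}| + 30 |M_{511}^{(5)}| - 60 |M_{1023}^{(5)}|$; $|\widetilde{M}_{94}^{(5)}| = |M_{94}^{(5)}| - |M_{95}^{(5)}| - |M_{119}^{(5)}| + 3 |M_{127}^{(5)}| - 6 |M_{222}^{(5)}| + 6 |M_{223}^{(5)}| - 2 |M_{237}^{(5)}| + 4 |M_{239}^{(5)}| + 8 |M_{254}^{(5)}| - 12 |M_{255}^{(5)}| - 16 |M_{507}^{(5)}| + 30 |M_{511}^{(5)}| - 60 |M_{1023}^{(5)}|$; $|\widetilde{M}_{95}^{(5)}| = |M_{95}^{(5)}| - 3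 |M_{127}^{(5)}| - 6 |M_{223}^{(5)}| - 2 |M_{239}^{(5)}| + 10 |M_{255}^{(5)}| + 4 |M_{507}^{(5)}| - 24 |M_{511}^{(5)}| + 60 |M_{1023}^{(5)}|$; $|\widetilde{M}_{117}^{(5)}| = |M_{117}^{(5)}| - 2 |M_{119}^{(5)}| + 3 |M_{127}^{(5)}| - 4 |M_{235}^{(5)}| - 2 |M_{237}^{(5)}| + 6 |M_{239}^{(5)}| + 6 |M_{254}^{(5)}| - 12 |M_{255}^{(5)}| - 16 |M_{507}^{(5)}| + 30 |M_{511}^{(5)}| - 60 |M_{1023}^{(5)}|$; $|\widetilde{M}_{119}^{(5)}| = |M_{119}^{(5)}| - 3 |M_{127}^{(5)}| - 2 |M_{239}^{(5)}| - 2 |M_{254}^{(5)}| + 8 |M_{255}^{(5)}| + 8 |M_{507}^{(5)}| - 24 |M_{511}^{(5)}| + 60 |M_{1023}^{(5)}|$; $|\widetilde{M}_{127}^{(5)}| = |M_{127}^{(5)}| - 2 |M_{255}^{(5)}| + 6 |M_{511}^{(5)}| - 20 |M_{1023}^{(5)}|$; $|\widetilde{M}_{222}^{(5)}| = |M_{222}^{(5)}| - |M_{223}^{(5)}| - |M_{254}^{(5)}| + |M_{255}^{(5)}| + 2 |M_{507}^{(5)}| - 4 |M_{511}^{(5)}| + 10 |M_{1023}^{(5)}|$; $|\widetilde{M}_{223}^{(5)}| = |M_{223}^{(5)}| - |M_{255}^{(5)}| + 3 |M_{511}^{(5)}| - 10 |M_{1023}^{(5)}|$; $|\widetilde{M}_{235}^{(5)}|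 = |M_{235}^{(5)}| - |M_{239}^{(5)}| + 2 |M_{255}^{(5)}| + 2 |M_{507}^{(5)}| - 6 |M_{511}^{(5)}| + 15 |M_{1023}^{(5)}|$; $|\widetilde{M}_{236}^{(5)}| = |M_{236}^{(5)}| - |M_{237}^{(5)}| + |M_{239}^{(5)}| + 2 |M_{254}^{(5)}| - 2 |M_{255}^{(5)}| - 4 |M_{507}^{(5)}| + 6 |M_{511}^{(5)}| - 12 |M_{1023}^{(5)}|$; $|\widetilde{M}_{237}^{(5)}| = |M_{237}^{(5)}| - 2 |M_{239}^{(5)}| - 4 |M_{254}^{(5)}| + 6 |M_{255}^{(5)}| + 12 |M_{507}^{(5)}| - 24 |M_{511}^{(5)}| + 60 |M_{1023}^{(5)}|$; $|\widetilde{M}_{239}^{(5)}| = |M_{239}^{(5)}| - 4 |M_{255}^{(5)}| - 4 |M_{507}^{(5)}| + 18 |M_{511}^{(5)}| - 60 |M_{1023}^{(5)}|$; $|\widetilde{M}_{254}^{(5)}| = |M_{254}^{(5)}| - |M_{255}^{(5)}| - 4 |M_{507}^{(5)}| + 9 |M_{511}^{(5)}| - 30 |M_{1023}^{(5)}|$; $|\widetilde{M}_{255}^{(5)}| = |M_{255}^{(5)}| - 6 |M_{511}^{(5)}| + 30 |M_{1023}^{(5)}|$; $|\widetilde{M}_{507}^{(5)}| = |M_{507}^{(5)}| - 3 |M_{511}^{(5)}| + 15 |M_{1023}^{(5)}|$; $|\widetilde{M}_{511}^{(5)}| = |M_{511}^{(5)}| - 10 |M_{1023}^{(5)}|$; $|\widetilde{M}_{1023}^{(5)}|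 = |M_{1023}^{(5)}|$.
   Context: For a fixed graph $F$ on five vertices, $|F|$ (non-induced count) is the number of subgraphs of $G$ (a vertex subset together with an edge subset) isomorphic to $F$, and $|\widetilde{F}|$ (induced count) is the number of $5$-element vertex subsets $W\subseteq V$ such that the induced subgraph $G[W]$ is isomorphic to $F$. The graphs $M_a^{(5)}$ are given by their edge sets on vertex set $\{1,\dots,5\}$: $M_{75}^{(5)}$: $\{15,25,35,45\}$; $M_{77}^{(5)}$: $\{15,25,35,34\}$; $M_{79}^{(5)}$: $\{15,25,34,35,45\}$; $M_{86}^{(5)}$: $\{15,24,34,35\}$; $M_{87}^{(5)}$: $\{15,24,34,35,45\}$; $M_{94}^{(5)}$: $\{15,24,25,34,35\}$; $M_{95}^{(5)}$: $\{15,24,25,34,35,45\}$; $M_{117}^{(5)}$: $\{15,23,24,34,45\}$; $M_{119}^{(5)}$: $\{15,23,24,34,35,45\}$; $M_{127}^{(5)}$: $\{15,23,24,25,34,35,45\}$; $M_{222}^{(5)}$: $\{14,15,24,25,34,35\}$; $M_{223}^{(5)}$: $\{14,15,24,25,34,35,45\}$; $M_{235}^{(5)}$: $\{14,15,23,25,35,45\}$; $M_{236}^{(5)}$: $\{14,15,23,25,34\}$; $M_{237}^{(5)}$: $\{14,15,23,25,34,45\}$; $M_{239}^{(5)}$: $\{14,15,23,25,34,35,45\}$; $M_{254}^{(5)}$: $\{14,15,23,24,25,34,35\}$; $M_{255}^{(5)}$: $\{14,15,23,24,25,34,35,45\}$; $M_{507}^{(5)}$: $\{13,14,15,23,24,25,35,45\}$;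 $M_{511}^{(5)}$: all pairs except $12$; $M_{1023}^{(5)}$: $K_5$. Write $|M_a^{(5)}|$ and $|\widetilde{M}_a^{(5)}|$ for the non-induced and induced counts of $M_a^{(5)}$ in $G$. *)

theory Defs
  imports Main
begin

type_synonym 'a graph = "'a set \<times> 'a set set"

abbreviation verts :: "'a graph \<Rightarrow> 'a set" where
  "verts G \<equiv> fst G"

abbreviation edges :: "'a graph \<Rightarrow> 'a set set" where
  "edges G \<equiv> snd G"

definition finite_simple_graph :: "'a graph \<Rightarrow> bool" where
  "finite_simple_graph G \<longleftrightarrow>
     finite (verts G) \<and> (\<forall>e \<in> edges G. e \<subseteq> verts G \<and> card e = 2)"

definition graph_iso :: "'a graph \<Rightarrow> 'b graph \<Rightarrow> bool" where
  "graph_iso G H \<longleftrightarrow>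
     (\<exists>f. bij_betw f (verts G) (verts H) \<and>
          (\<forall>u \<in> verts G. \<forall>v \<in> verts G. {u, v} \<in> edges G \<longleftrightarrow> {f u, f v} \<in> edges H))"

definition subgraph :: "'a graph \<Rightarrow> 'a graph \<Rightarrow> bool" where
  "subgraph H G \<longleftrightarrow>
     verts H \<subseteq> verts G \<and> edges H \<subseteq> edges G \<and> (\<forall>e \<in> edges H. e \<subseteq> verts H)"

definition induced_subgraph :: "'a graph \<Rightarrow> 'a set \<Rightarrow> 'a graph" where
  "induced_subgraph G W = (W, {e \<in> edges G. e \<subseteq> W})"

text \<open>Both counts are for patterns \<open>F\<close> on five vertices. They are integer-valued because they
  are combined with signs.\<close>

definition noninduced_count :: "'a graph \<Rightarrow> 'b graph \<Rightarrow> int" where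
  "noninduced_count G F = int (card {H. subgraph H G \<and> graph_iso H F})"

definition induced_count :: "'a graph \<Rightarrow> 'b graph \<Rightarrow> int" where
  "induced_count G F =
     int (card {W. W \<subseteq> verts G \<and> card W = 5 \<and> graph_iso (induced_subgraph G W) F})"

definition M75 :: "nat graph" where
  "M75 = ({1..5}, {{1, 5}, {2, 5}, {3, 5}, {4, 5}})"

definition M77 :: "nat graph" where
  "M77 = ({1..5}, {{1, 5}, {2, 5}, {3, 5}, {3, 4}})"

definition M79 :: "nat graph" where
  "M79 = ({1..5}, {{1, 5}, {2, 5}, {3, 4}, {3, 5}, {4, 5}})"

definition M86 :: "nat graph" where
  "M86 = ({1..5}, {{1, 5}, {2, 4}, {3, 4}, {3, 5}})"

definition M87 :: "nat graph" where
  "M87 = ({1..5}, {{1, 5}, {2, 4}, {3, 4}, {3, 5}, {4, 5}})"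

definition M94 :: "nat graph" where
  "M94 = ({1..5}, {{1, 5}, {2, 4}, {2, 5}, {3, 4}, {3, 5}})"

definition M95 :: "nat graph" where
  "M95 = ({1..5}, {{1, 5}, {2, 4}, {2, 5}, {3, 4}, {3, 5}, {4, 5}})"

definition M117 :: "nat graph" where
  "M117 = ({1..5}, {{1, 5}, {2, 3}, {2, 4}, {3, 4}, {4, 5}})"

definition M119 :: "nat graph" where
  "M119 = ({1..5}, {{1, 5}, {2, 3}, {2, 4}, {3, 4}, {3, 5}, {4, 5}})"

definition M127 :: "nat graph" where
  "M127 = ({1..5}, {{1, 5}, {2, 3}, {2, 4}, {2, 5}, {3, 4}, {3, 5}, {4, 5}})"

definition M222 :: "nat graph" where
  "M222 = ({1..5}, {{1, 4}, {1, 5}, {2, 4}, {2, 5}, {3, 4}, {3, 5}})"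

definition M223 :: "nat graph" where
  "M223 = ({1..5}, {{1, 4}, {1, 5}, {2, 4}, {2, 5}, {3, 4}, {3, 5}, {4, 5}})"

definition M235 :: "nat graph" where
  "M235 = ({1..5}, {{1, 4}, {1, 5}, {2, 3}, {2, 5}, {3, 5}, {4, 5}})"

definition M236 :: "nat graph" where
  "M236 = ({1..5}, {{1, 4}, {1, 5}, {2, 3}, {2, 5}, {3, 4}})"

definition M237 :: "nat graph" where
  "M237 = ({1..5}, {{1, 4}, {1, 5}, {2, 3}, {2, 5}, {3, 4}, {4, 5}})"

definition M239 :: "nat graph" where
  "M239 = ({1..5}, {{1, 4}, {1, 5}, {2, 3}, {2, 5}, {3, 4}, {3, 5}, {4, 5}})"

definition M254 :: "nat graph" where
  "M254 = ({1..5}, {{1, 4}, {1, 5}, {2, 3}, {2, 4}, {2, 5}, {3, 4}, {3, 5}})"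

definition M255 :: "nat graph" where
  "M255 = ({1..5}, {{1, 4}, {1, 5}, {2, 3}, {2, 4}, {2, 5}, {3, 4}, {3, 5}, {4, 5}})"

definition M507 :: "nat graph" where
  "M507 = ({1..5}, {{1, 3}, {1, 4}, {1, 5}, {2, 3}, {2, 4}, {2, 5}, {3, 5}, {4, 5}})"

definition M511 :: "nat graph" where
  "M511 = ({1..5}, {{1, 3}, {1, 4}, {1, 5}, {2, 3}, {2, 4}, {2, 5}, {3, 4}, {3, 5}, {4, 5}})"

definition M1023 :: "nat graph" where
  "M1023 = ({1..5}, {{1, 2}, {1, 3}, {1, 4}, {1, 5}, {2, 3}, {2, 4}, {2, 5}, {3, 4}, {3, 5}, {4, 5}})"

end

theory Submission
  imports Defs "HOL-Combinatorics.Multiset_Permutations"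
begin

text \<open>
  A copy of \<open>F\<close> in \<open>G\<close> lies in the subgraph induced on its five vertices. Up to isomorphism the
  21 patterns are closed under the insertion of an edge, so an induced subgraph that contains a
  copy of a pattern is isomorphic to exactly one pattern. Hence
  \<open>|F| = (\<Sum>H. c(F, H) * |H\<^sup>~|)\<close>, where \<open>H\<close> runs over the patterns, \<open>|H\<^sup>~|\<close> is the induced count
  and \<open>c(F, H)\<close> is the number of copies of \<open>F\<close> in \<open>H\<close>. The claimed identities are the solution of
  this unitriangular linear system. The numbers \<open>c(F, H)\<close> are found by listing the copies of \<open>F\<close>
  in the complete graph, which are the distinct images of \<open>F\<close> under the vertex permutations, as bit
  vectors.
\<close>

subsection \<open>Isomorphisms\<close>

definition isomorphism :: "('a \<Rightarrow> 'b) \<Rightarrow> 'a graph \<Rightarrow> 'b graph \<Rightarrow> bool" where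
  "isomorphism f G H \<longleftrightarrow> bij_betw f (verts G) (verts H) \<and>
     (\<forall>u \<in> verts G. \<forall>v \<in> verts G. {u, v} \<in> edges G \<longleftrightarrow> {f u, f v} \<in> edges H)"

lemma graph_iso_iff_isomorphism: "graph_iso G H \<longleftrightarrow> (\<exists>f. isomorphism f G H)"
  by (simp add: graph_iso_def isomorphism_def)

lemma isomorphism_inv_into:
  assumes "isomorphism f G H"
  shows "isomorphism (inv_into (verts G) f) H G"
proof -
  let ?g = "inv_into (verts G) f"
  from assms have f: "bij_betw f (verts G) (verts H)" by (simp add: isomorphism_def)
  then have g: "bij_betw ?g (verts H) (verts G)" by (rule bij_betw_inv_into)
  have "{u, v} \<in> edges H \<longleftrightarrow> {?g u, ?g v} \<in> edges G" if "u \<in> verts H" "v \<in> verts H" for u v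
    using assms that bij_betw_apply[OF g] bij_betw_inv_into_right[OF f] by (simp add: isomorphism_def)
  with g show ?thesis by (simp add: isomorphism_def)
qed

lemma isomorphism_comp:
  assumes "isomorphism f G H" "isomorphism g H K"
  shows "isomorphism (g \<circ> f) G K"
  using assms bij_betw_apply[of f "verts G" "verts H"]
  unfolding isomorphism_def by (auto intro: bij_betw_trans)

lemma isomorphism_insert_edge:
  assumes f: "isomorphism f G H" and e: "e \<subseteq> verts G"
  shows "isomorphism f (verts G, insert e (edges G)) (verts H, insert (f ` e) (edges H))"
proof -
  have inj: "inj_on f (verts G)" using f by (simp add: isomorphism_def bij_betw_def)
  have "{u, v} = e \<longleftrightarrow> {f u, f v} = f ` e" if "u \<in> verts G" "v \<in> verts G" for u v
    using inj_on_image_eq_iff[OF inj, of "{u, v}" e] that e by simp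
  with f show ?thesis by (simp add: isomorphism_def)
qed

definition graph_image :: "('a \<Rightarrow> 'b) \<Rightarrow> 'a graph \<Rightarrow> 'b graph" where
  "graph_image f G = (f ` verts G, (`) f ` edges G)"

lemma isomorphism_graph_image:
  assumes edge_subset: "\<And>e. e \<in> edges G \<Longrightarrow> e \<subseteq> verts G" and inj: "inj_on f (verts G)"
  shows "isomorphism f G (graph_image f G)"
proof -
  have "{u, v} \<in> edges G \<longleftrightarrow> {f u, f v} \<in> (`) f ` edges G" if "u \<in> verts G" "v \<in> verts G" for u v
  proof -
    have "f ` {u, v} = f ` e \<longleftrightarrow> {u, v} = e" if "e \<in> edges G" for e
      using inj_on_image_eq_iff[OF inj, of "{u, v}" e] edge_subset[OF that] \<open>u \<in> verts G\<close> \<open>v \<in> verts G\<close>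
      by simp
    then show ?thesis by (auto simp: image_iff)
  qed
  then show ?thesis
    using inj by (simp add: isomorphism_def graph_image_def bij_betw_def)
qed

lemma graph_iso_refl: "graph_iso G G"
  unfolding graph_iso_def by (rule exI[of _ id]) simp

lemma graph_iso_sym: "graph_iso G H \<Longrightarrow> graph_iso H G"
  unfolding graph_iso_iff_isomorphism using isomorphism_inv_into by blast

lemma graph_iso_trans: "graph_iso G H \<Longrightarrow> graph_iso H K \<Longrightarrow> graph_iso G K"
  unfolding graph_iso_iff_isomorphism using isomorphism_comp by blast

lemma graph_iso_card_verts: "graph_iso G H \<Longrightarrow> card (verts G) = card (verts H)"
  unfolding graph_iso_def by (auto dest: bij_betw_same_card)

lemma finite_simple_graph_edge:
  assumes "finite_simple_graph G" "e \<in> edges G"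
  obtains u v where "e = {u, v}" "u \<noteq> v" "u \<in> verts G" "v \<in> verts G"
  using assms unfolding finite_simple_graph_def card_2_iff by force

lemma edges_subset_iff:
  assumes "finite_simple_graph G"
  shows "edges G \<subseteq> E \<longleftrightarrow> (\<forall>u \<in> verts G. \<forall>v \<in> verts G. {u, v} \<in> edges G \<longrightarrow> {u, v} \<in> E)"
proof
  assume pairs: "\<forall>u \<in> verts G. \<forall>v \<in> verts G. {u, v} \<in> edges G \<longrightarrow> {u, v} \<in> E"
  show "edges G \<subseteq> E"
  proof
    fix e assume "e \<in> edges G"
    with assms pairs show "e \<in> E" by (metis finite_simple_graph_edge)
  qed
qed blast

lemma finite_edges:
  assumes "finite_simple_graph G"
  shows "finite (edges G)"
  by (rule finite_subset[of _ "Pow (verts G)"]) (use assms in \<open>auto simp: finite_simple_graph_def\<close>)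

lemma finite_simple_graph_induced_subgraph:
  assumes "finite_simple_graph G" "W \<subseteq> verts G"
  shows "finite_simple_graph (induced_subgraph G W)"
  using assms unfolding finite_simple_graph_def induced_subgraph_def by (auto intro: finite_subset)

subsection \<open>Families of graphs closed under the insertion of edges\<close>

definition insert_edge_closed :: "'a graph set \<Rightarrow> bool" where
  "insert_edge_closed \<F> \<longleftrightarrow> (\<forall>H \<in> \<F>. \<forall>e. e \<subseteq> verts H \<and> card e = 2 \<longrightarrow>
     (\<exists>K \<in> \<F>. graph_iso (verts H, insert e (edges H)) K))"

lemma insert_edge_closed_supergraph:
  assumes closed: "insert_edge_closed \<F>" and T: "finite_simple_graph T"
    and S: "S \<subseteq> edges T" "H \<in> \<F>" "graph_iso (verts T, S) H"
  shows "\<exists>K \<in> \<F>. graph_iso T K"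
proof -
  have "\<exists>K \<in> \<F>. graph_iso (verts T, D \<union> S) K" if "finite D" "D \<subseteq> edges T" for D
    using that
  proof (induction rule: finite_induct)
    case empty
    then show ?case using S by auto
  next
    case (insert e D)
    then obtain H f where H: "H \<in> \<F>" and f: "isomorphism f (verts T, D \<union> S) H"
      unfolding graph_iso_iff_isomorphism by blast
    have e: "e \<subseteq> verts T" "card e = 2"
      using insert.prems T by (auto simp: finite_simple_graph_def)
    have bij: "bij_betw f (verts T) (verts H)" using f by (simp add: isomorphism_def)
    then have "f ` e \<subseteq> verts H" "card (f ` e) = 2"
      using e card_image[OF inj_on_subset[OF bij_betw_imp_inj_on[OF bij]]]
      by (auto simp: bij_betw_def)
    with closed H obtain K where K: "K \<in> \<F>" "graph_iso (verts H, insert (f ` e) (edges H)) K"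
      unfolding insert_edge_closed_def by blast
    have "graph_iso (verts T, insert e D \<union> S) (verts H, insert (f ` e) (edges H))"
      using isomorphism_insert_edge[OF f] e(1) unfolding graph_iso_iff_isomorphism by auto
    with K show ?case using graph_iso_trans by blast
  qed
  from this[of "edges T"] finite_edges[OF T] S(1) show ?thesis by (simp add: Un_absorb2)
qed

subsection \<open>Counting copies\<close>

definition copies :: "'b graph \<Rightarrow> 'a graph \<Rightarrow> 'a graph set" where
  "copies F G = {H. subgraph H G \<and> graph_iso H F}"

lemma noninduced_count_eq_card_copies: "noninduced_count G F = int (card (copies F G))"
  by (simp add: noninduced_count_def copies_def)

lemma finite_copies:
  assumes "finite_simple_graph G"
  shows "finite (copies F G)"
proof (rule finite_subset)
  show "copies F G \<subseteq> Pow (verts G) \<times> Pow (edges G)"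
    by (auto simp: copies_def subgraph_def)
  show "finite (Pow (verts G) \<times> Pow (edges G))"
    using assms finite_edges[OF assms] by (simp add: finite_simple_graph_def)
qed

lemma verts_eq_if_mem_copies:
  assumes "H \<in> copies F T" "finite_simple_graph T" "card (verts T) = card (verts F)"
  shows "verts H = verts T"
  using assms graph_iso_card_verts[of H F]
  by (intro card_subset_eq) (auto simp: copies_def subgraph_def finite_simple_graph_def)

lemma finite_simple_graph_copy:
  assumes "finite_simple_graph T" "H \<in> copies F T"
  shows "finite_simple_graph H"
  using assms unfolding finite_simple_graph_def copies_def subgraph_def by (auto intro: finite_subset)

lemma graph_image_mem_copies:
  assumes f: "isomorphism f T U" and T: "finite_simple_graph T" and H: "H \<in> copies F T"
  shows "graph_image f H \<in> copies F U"
proof -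
  from H have sub: "subgraph H T" and iso: "graph_iso H F" by (simp_all add: copies_def)
  from f have bij: "bij_betw f (verts T) (verts U)" by (simp add: isomorphism_def)
  have "f ` e \<in> edges U" if "e \<in> edges T" for e
    using T that
  proof (rule finite_simple_graph_edge)
    fix u v assume "e = {u, v}" "u \<in> verts T" "v \<in> verts T"
    with f that show ?thesis by (simp add: isomorphism_def)
  qed
  then have "subgraph (graph_image f H) U"
    using sub bij by (fastforce simp: subgraph_def graph_image_def bij_betw_def)
  moreover have "isomorphism f H (graph_image f H)"
    using sub inj_on_subset[OF bij_betw_imp_inj_on[OF bij]]
    by (intro isomorphism_graph_image) (auto simp: subgraph_def)
  then have "graph_iso (graph_image f H) F"
    using iso graph_iso_sym graph_iso_trans graph_iso_iff_isomorphism by blast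
  ultimately show ?thesis by (simp add: copies_def)
qed

lemma noninduced_count_le_if_graph_iso:
  assumes T: "finite_simple_graph T" and U: "finite_simple_graph U" and iso: "graph_iso T U"
  shows "noninduced_count T F \<le> noninduced_count U F"
proof -
  from iso obtain f where f: "isomorphism f T U" unfolding graph_iso_iff_isomorphism by blast
  then have inj: "inj_on f (verts T)" by (simp add: isomorphism_def bij_betw_def)
  have "inj_on (graph_image f) (copies F T)"
  proof (rule inj_on_subset)
    show "inj_on (graph_image f) (Pow (verts T) \<times> Pow (Pow (verts T)))"
      using map_prod_inj_on[OF inj_on_image_Pow[OF inj] inj_on_image_Pow[OF inj_on_image_Pow[OF inj]]]
      by (simp add: graph_image_def inj_on_def split: prod.splits)
    show "copies F T \<subseteq> Pow (verts T) \<times> Pow (Pow (verts T))"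
      unfolding copies_def subgraph_def by fastforce
  qed
  moreover have "graph_image f ` copies F T \<subseteq> copies F U"
    using graph_image_mem_copies[OF f T] by blast
  ultimately show ?thesis
    unfolding noninduced_count_eq_card_copies
    using card_inj_on_le[OF _ _ finite_copies[OF U]] by simp
qed

lemma noninduced_count_eq_if_graph_iso:
  assumes "finite_simple_graph T" "finite_simple_graph U" "graph_iso T U"
  shows "noninduced_count T F = noninduced_count U F"
  using assms graph_iso_sym by (intro antisym noninduced_count_le_if_graph_iso)

lemma noninduced_count_eq_sum_induced_subgraph:
  assumes G: "finite_simple_graph G"
  shows "noninduced_count G F =
    (\<Sum>W | W \<subseteq> verts G \<and> card W = card (verts F). noninduced_count (induced_subgraph G W) F)"
proof -
  let ?\<W> = "{W. W \<subseteq> verts G \<and> card W = card (verts F)}"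
  have fin: "finite (verts G)" using G by (simp add: finite_simple_graph_def)
  have verts_copy: "verts H = W" if "W \<in> ?\<W>" "H \<in> copies F (induced_subgraph G W)" for W H
  proof -
    have "finite_simple_graph (induced_subgraph G W)"
      using that(1) by (intro finite_simple_graph_induced_subgraph[OF G]) simp
    from verts_eq_if_mem_copies[OF that(2) this] that(1) show ?thesis
      by (simp add: induced_subgraph_def)
  qed
  have "copies F G = (\<Union>W \<in> ?\<W>. copies F (induced_subgraph G W))"
  proof (intro equalityI subsetI)
    fix H assume "H \<in> copies F G"
    then have "verts H \<in> ?\<W>" "H \<in> copies F (induced_subgraph G (verts H))"
      by (auto simp: copies_def subgraph_def induced_subgraph_def dest: graph_iso_card_verts)
    then show "H \<in> (\<Union>W \<in> ?\<W>. copies F (induced_subgraph G W))" by blast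
  qed (auto simp: copies_def subgraph_def induced_subgraph_def)
  also have "card \<dots> = (\<Sum>W \<in> ?\<W>. card (copies F (induced_subgraph G W)))"
  proof (rule card_UN_disjoint)
    show "finite ?\<W>" using fin by simp
    show "\<forall>W \<in> ?\<W>. finite (copies F (induced_subgraph G W))"
      using finite_copies[OF finite_simple_graph_induced_subgraph[OF G]] by blast
    show "\<forall>W \<in> ?\<W>. \<forall>W' \<in> ?\<W>. W \<noteq> W' \<longrightarrow>
        copies F (induced_subgraph G W) \<inter> copies F (induced_subgraph G W') = {}"
      using verts_copy by blast
  qed
  finally show ?thesis by (simp add: noninduced_count_eq_card_copies)
qed

lemma noninduced_count_eq_zero_if_not_graph_iso:
  assumes closed: "insert_edge_closed \<F>" and F: "F \<in> \<F>"
    and T: "finite_simple_graph T" "card (verts T) = card (verts F)"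
    and not_iso: "\<And>H. H \<in> \<F> \<Longrightarrow> \<not> graph_iso T H"
  shows "noninduced_count T F = 0"
proof -
  have False if "H \<in> copies F T" for H
  proof -
    from that have "graph_iso H F" by (simp add: copies_def)
    then have "graph_iso (verts T, edges H) F"
      using verts_eq_if_mem_copies[OF that T] by (metis prod.collapse)
    then show False
      using insert_edge_closed_supergraph[OF closed T(1) _ F] that not_iso
      by (auto simp: copies_def subgraph_def)
  qed
  then have "copies F T = {}" by blast
  then show ?thesis by (simp add: noninduced_count_eq_card_copies)
qed

lemma noninduced_count_eq_sum_graph_iso:
  fixes \<F> :: "'b graph set"
  assumes fin: "finite \<F>" and closed: "insert_edge_closed \<F>"
    and simple: "\<And>H. H \<in> \<F> \<Longrightarrow> finite_simple_graph H"
    and non_iso: "\<And>H K. H \<in> \<F> \<Longrightarrow> K \<in> \<F> \<Longrightarrow> graph_iso H K \<Longrightarrow> H = K" and F: "F \<in> \<F>"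
    and T: "finite_simple_graph T" "card (verts T) = card (verts F)"
  shows "noninduced_count T F = (\<Sum>H \<in> \<F>. noninduced_count H F * of_bool (graph_iso T H))"
proof (cases "\<exists>K \<in> \<F>. graph_iso T K")
  case True
  then obtain K where K: "K \<in> \<F>" "graph_iso T K" by blast
  have "graph_iso T H \<longleftrightarrow> H = K" if "H \<in> \<F>" for H
    using that K non_iso graph_iso_trans[OF graph_iso_sym] by blast
  then have "(\<Sum>H \<in> \<F>. noninduced_count H F * of_bool (graph_iso T H))
      = (\<Sum>H \<in> \<F>. if H = K then noninduced_count K F else 0)"
    by (intro sum.cong) auto
  then show ?thesis
    using fin K noninduced_count_eq_if_graph_iso[OF T(1) simple] by simp
next
  case False
  then have "noninduced_count T F = 0"
    using noninduced_count_eq_zero_if_not_graph_iso[OF closed F T] by blast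
  with False show ?thesis by simp
qed

theorem noninduced_count_eq_sum_induced_count:
  fixes G :: "'a graph" and \<F> :: "'b graph set"
  assumes G: "finite_simple_graph G" and fin: "finite \<F>" and closed: "insert_edge_closed \<F>"
    and simple: "\<And>H. H \<in> \<F> \<Longrightarrow> finite_simple_graph H"
    and non_iso: "\<And>H K. H \<in> \<F> \<Longrightarrow> K \<in> \<F> \<Longrightarrow> graph_iso H K \<Longrightarrow> H = K"
    and F: "F \<in> \<F>" "card (verts F) = 5"
  shows "noninduced_count G F = (\<Sum>H \<in> \<F>. noninduced_count H F * induced_count G H)"
proof -
  let ?\<W> = "{W. W \<subseteq> verts G \<and> card W = 5}"
  have "noninduced_count G F = (\<Sum>W \<in> ?\<W>. noninduced_count (induced_subgraph G W) F)"
    using noninduced_count_eq_sum_induced_subgraph[OF G, of F] F(2) by simp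
  also have "\<dots> = (\<Sum>W \<in> ?\<W>. \<Sum>H \<in> \<F>.
      noninduced_count H F * of_bool (graph_iso (induced_subgraph G W) H))"
  proof (intro sum.cong refl noninduced_count_eq_sum_graph_iso[OF fin closed simple non_iso F(1)])
    fix W assume "W \<in> ?\<W>"
    then show "finite_simple_graph (induced_subgraph G W)"
      "card (verts (induced_subgraph G W)) = card (verts F)"
      using finite_simple_graph_induced_subgraph[OF G] F(2) by (auto simp: induced_subgraph_def)
  qed
  also have "\<dots> = (\<Sum>H \<in> \<F>. noninduced_count H F *
      (\<Sum>W \<in> ?\<W>. of_bool (graph_iso (induced_subgraph G W) H)))"
    by (subst sum.swap) (simp add: sum_distrib_left)
  also have "\<dots> = (\<Sum>H \<in> \<F>. noninduced_count H F * induced_count G H)"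
  proof -
    have "finite ?\<W>" using G by (simp add: finite_simple_graph_def)
    then show ?thesis by (simp add: induced_count_def Int_def conj_assoc)
  qed
  finally show ?thesis .
qed

subsection \<open>Edge vectors\<close>

text \<open>The edge vector of \<open>M\<^sub>a\<close> along \<open>[1, \<dots>, 5]\<close> consists of the binary digits of \<open>a\<close>.\<close>

fun edge_vector :: "'a graph \<Rightarrow> 'a list \<Rightarrow> bool list" where
  "edge_vector G [] = []"
| "edge_vector G (x # xs) = map (\<lambda>y. {x, y} \<in> edges G) xs @ edge_vector G xs"

lemma list_all2_edge_vector_iff_pairwise:
  assumes "distinct xs"
  shows "list_all2 P (edge_vector G (map f xs)) (edge_vector H xs) \<longleftrightarrow>
    pairwise (\<lambda>u v. P ({f u, f v} \<in> edges G) ({u, v} \<in> edges H)) (set xs)"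
  using assms
proof (induction xs)
  case (Cons x xs)
  have "list_all2 P (edge_vector G (map f (x # xs))) (edge_vector H (x # xs)) \<longleftrightarrow>
      (\<forall>y \<in> set xs. P ({f x, f y} \<in> edges G) ({x, y} \<in> edges H)) \<and>
      list_all2 P (edge_vector G (map f xs)) (edge_vector H xs)"
    by (simp add: list_all2_append list_all2_map1 list_all2_map2 list_all2_same)
  with Cons show ?case
    by (auto simp: pairwise_insert insert_commute)
qed (simp add: pairwise_def)

lemma list_all2_edge_vector_iff:
  assumes "finite_simple_graph G" "finite_simple_graph H" "distinct xs" "P False False"
  shows "list_all2 P (edge_vector G (map f xs)) (edge_vector H xs) \<longleftrightarrow>
    (\<forall>u \<in> set xs. \<forall>v \<in> set xs. P ({f u, f v} \<in> edges G) ({u, v} \<in> edges H))"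
proof -
  have "{u, u} \<notin> edges G" "{v, v} \<notin> edges H" for u v
    using assms(1,2) by (auto simp: finite_simple_graph_def)
  then show ?thesis
    unfolding list_all2_edge_vector_iff_pairwise[OF assms(3)] pairwise_def using assms(4) by metis
qed

lemma isomorphism_iff_edge_vector:
  assumes "finite_simple_graph G" "finite_simple_graph H"
    and "distinct xs" "verts H = set xs" "bij_betw f (set xs) (verts G)"
  shows "isomorphism f H G \<longleftrightarrow> edge_vector H xs = edge_vector G (map f xs)"
  using list_all2_edge_vector_iff[OF assms(1-3), of "(=)" f] assms(4,5)
  unfolding list.rel_eq isomorphism_def bij_betw_def by auto

lemma subgraph_iff_edge_vector:
  assumes H: "finite_simple_graph H" and T: "finite_simple_graph T"
    and verts: "verts H = set xs" "verts T = set xs" and xs: "distinct xs"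
  shows "subgraph H T \<longleftrightarrow> list_all2 (\<longrightarrow>) (edge_vector H xs) (edge_vector T xs)"
proof -
  have "subgraph H T \<longleftrightarrow> edges H \<subseteq> edges T"
    using H verts by (auto simp: subgraph_def finite_simple_graph_def)
  also have "\<dots> \<longleftrightarrow> (\<forall>u \<in> set xs. \<forall>v \<in> set xs. {u, v} \<in> edges H \<longrightarrow> {u, v} \<in> edges T)"
    unfolding edges_subset_iff[OF H] verts(1) ..
  also have "\<dots> \<longleftrightarrow> list_all2 (\<longrightarrow>) (edge_vector H xs) (edge_vector T xs)"
    using list_all2_edge_vector_iff[OF H T xs, of "(\<longrightarrow>)" id] by simp
  finally show ?thesis .
qed

lemma edge_vector_inject:
  assumes "finite_simple_graph G" "finite_simple_graph H" "verts G = set xs" "verts H = set xs"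
    and "distinct xs" "edge_vector G xs = edge_vector H xs"
  shows "G = H"
proof -
  have "subgraph G H" "subgraph H G"
    using assms by (simp_all add: subgraph_iff_edge_vector list.rel_refl)
  then show ?thesis by (auto simp: subgraph_def intro: prod_eqI)
qed

lemma permutations_of_set_eq_map_bij_betw:
  assumes "distinct xs"
  shows "permutations_of_set (set xs) = (\<lambda>f. map f xs) ` {f. bij_betw f (set xs) (set xs)}"
proof (intro equalityI subsetI)
  fix ys assume "ys \<in> permutations_of_set (set xs)"
  then have ys: "set ys = set xs" "distinct ys" by (auto dest: permutations_of_setD)
  then have len: "length xs = length ys" using assms distinct_card by metis
  let ?f = "the \<circ> map_of (zip xs ys)"
  have map_eq: "map ?f xs = ys"
    using len assms by (intro nth_equalityI) (simp_all add: map_of_zip_nth)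
  then have "inj_on ?f (set xs)" using ys(2) by (metis distinct_map)
  then have "bij_betw ?f (set xs) (set xs)"
    using map_eq ys(1) by (metis bij_betw_def list.set_map)
  with map_eq show "ys \<in> (\<lambda>f. map f xs) ` {f. bij_betw f (set xs) (set xs)}" by force
next
  fix ys assume "ys \<in> (\<lambda>f. map f xs) ` {f. bij_betw f (set xs) (set xs)}"
  then show "ys \<in> permutations_of_set (set xs)"
    using assms by (auto simp: bij_betw_def distinct_map intro!: permutations_of_setI)
qed

definition edge_vectors :: "'a graph \<Rightarrow> 'a list \<Rightarrow> bool list list" where
  "edge_vectors F xs = remdups (map (edge_vector F) (permutations_of_set_list xs))"

lemma set_edge_vectors:
  assumes "distinct xs"
  shows "set (edge_vectors F xs) = (\<lambda>f. edge_vector F (map f xs)) ` {f. bij_betw f (set xs) (set xs)}"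
proof -
  have "set (permutations_of_set_list xs) = (\<lambda>f. map f xs) ` {f. bij_betw f (set xs) (set xs)}"
    using permutations_of_set_eq_map_bij_betw[OF assms] permutations_of_list[of xs] assms
    by (simp add: distinct_remdups_id)
  then show ?thesis by (simp add: edge_vectors_def image_image)
qed

lemma graph_iso_iff_edge_vector:
  assumes "finite_simple_graph H" "finite_simple_graph F"
    and "verts H = set xs" "verts F = set xs" "distinct xs"
  shows "graph_iso H F \<longleftrightarrow> edge_vector H xs \<in> set (edge_vectors F xs)"
proof -
  have "graph_iso H F \<longleftrightarrow> (\<exists>f. bij_betw f (set xs) (set xs) \<and> isomorphism f H F)"
    using assms(3,4) unfolding graph_iso_iff_isomorphism isomorphism_def by auto
  also have "\<dots> \<longleftrightarrow> (\<exists>f. bij_betw f (set xs) (set xs) \<and> edge_vector H xs = edge_vector F (map f xs))"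
    using isomorphism_iff_edge_vector[OF assms(2,1,5,3)] assms(4) by metis
  finally show ?thesis unfolding set_edge_vectors[OF assms(5)] by blast
qed

lemma ex_graph_edge_vector:
  assumes F: "finite_simple_graph F" and verts: "verts F = set xs" and xs: "distinct xs"
    and v: "v \<in> set (edge_vectors F xs)"
  obtains H where "finite_simple_graph H" "verts H = set xs" "edge_vector H xs = v"
proof -
  from v xs obtain f where f: "bij_betw f (set xs) (set xs)" and v_eq: "v = edge_vector F (map f xs)"
    by (auto simp: set_edge_vectors)
  let ?H = "(set xs, {e. e \<subseteq> set xs \<and> f ` e \<in> edges F})"
  have inj: "inj_on f (set xs)" using f by (rule bij_betw_imp_inj_on)
  have "card e = 2" if "e \<subseteq> set xs" "f ` e \<in> edges F" for e
    using F that card_image[OF inj_on_subset[OF inj that(1)]] by (auto simp: finite_simple_graph_def)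
  then have simple: "finite_simple_graph ?H" by (simp add: finite_simple_graph_def)
  have "isomorphism f ?H F" using f verts by (simp add: isomorphism_def)
  then have "edge_vector ?H xs = v"
    using isomorphism_iff_edge_vector[OF F simple xs, of f] f verts v_eq by simp
  with simple that[of ?H] show thesis by simp
qed

lemma noninduced_count_eq_length_filter_edge_vectors:
  assumes F: "finite_simple_graph F" and T: "finite_simple_graph T"
    and verts: "verts F = set xs" "verts T = set xs" and xs: "distinct xs"
  shows "noninduced_count T F =
    int (length (filter (\<lambda>v. list_all2 (\<longrightarrow>) v (edge_vector T xs)) (edge_vectors F xs)))"
proof -
  let ?A = "{v \<in> set (edge_vectors F xs). list_all2 (\<longrightarrow>) v (edge_vector T xs)}"
  have copy: "finite_simple_graph H \<and> verts H = set xs" if "H \<in> copies F T" for H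
    using finite_simple_graph_copy[OF T that] verts_eq_if_mem_copies[OF that T] verts by simp
  have mem_copies: "H \<in> copies F T \<longleftrightarrow> edge_vector H xs \<in> ?A"
    if "finite_simple_graph H" "verts H = set xs" for H
    using that subgraph_iff_edge_vector[OF that(1) T that(2) verts(2) xs]
      graph_iso_iff_edge_vector[OF that(1) F that(2) verts(1) xs] by (simp add: copies_def conj_commute)
  have "bij_betw (\<lambda>H. edge_vector H xs) (copies F T) ?A"
  proof (rule bij_betw_imageI)
    show "inj_on (\<lambda>H. edge_vector H xs) (copies F T)"
      using copy edge_vector_inject xs by (intro inj_onI) blast
    have "v \<in> (\<lambda>H. edge_vector H xs) ` copies F T" if "v \<in> ?A" for v
    proof -
      from that obtain H where "finite_simple_graph H" "verts H = set xs" "edge_vector H xs = v"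
        using ex_graph_edge_vector[OF F verts(1) xs] by blast
      with mem_copies that show ?thesis by blast
    qed
    then show "(\<lambda>H. edge_vector H xs) ` copies F T = ?A"
      using copy mem_copies by blast
  qed
  then have "card (copies F T) = card ?A" by (rule bij_betw_same_card)
  also have "\<dots> = length (filter (\<lambda>v. list_all2 (\<longrightarrow>) v (edge_vector T xs)) (edge_vectors F xs))"
    using distinct_card[of "filter (\<lambda>v. list_all2 (\<longrightarrow>) v (edge_vector T xs)) (edge_vectors F xs)"]
    by (simp add: edge_vectors_def)
  finally show ?thesis by (simp add: noninduced_count_eq_card_copies)
qed

subsection \<open>The patterns on five vertices\<close>

definition patterns :: "nat graph list" where
  "patterns = [M75, M77, M79, M86, M87, M94, M95, M117, M119, M127, M222, M223, M235, M236,
     M237, M239, M254, M255, M507, M511, M1023]"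

text \<open>The entry in row \<open>i\<close> and column \<open>j\<close> is the number of copies of pattern \<open>i\<close> in pattern \<open>j\<close>.\<close>

definition copy_counts :: "int list list" where
  "copy_counts =
  [[1, 0, 1, 0, 0, 0, 1, 0, 0, 1, 0, 2, 1, 0, 0, 1, 0, 2, 1, 3, 5],
   [0, 1, 2, 0, 2, 2, 5, 1, 4, 9, 6, 12, 4, 0, 4, 10, 10, 20, 20, 36, 60],
   [0, 0, 1, 0, 0, 0, 2, 0, 0, 3, 0, 6, 2, 0, 0, 3, 0, 8, 4, 15, 30],
   [0, 0, 0, 1, 1, 2, 2, 2, 4, 6, 6, 6, 4, 5, 7, 10, 14, 18, 24, 36, 60],
   [0, 0, 0, 0, 1, 0, 2, 0, 2, 6, 0, 6, 0, 0, 1, 5, 4, 14, 12, 30, 60],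
   [0, 0, 0, 0, 0, 1, 1, 0, 1, 3, 6, 6, 0, 0, 2, 4, 8, 12, 16, 30, 60],
   [0, 0, 0, 0, 0, 0, 1, 0, 0, 3, 0, 6, 0, 0, 0, 2, 0, 10, 4, 24, 60],
   [0, 0, 0, 0, 0, 0, 0, 1, 2, 3, 0, 0, 4, 0, 2, 6, 6, 12, 16, 30, 60],
   [0, 0, 0, 0, 0, 0, 0, 0, 1, 3, 0, 0, 0, 0, 0, 2, 2, 8, 8, 24, 60],
   [0, 0, 0, 0, 0, 0, 0, 0, 0, 1, 0, 0, 0, 0, 0, 0, 0, 2, 0, 6, 20],
   [0, 0, 0, 0, 0, 0, 0, 0, 0, 0, 1, 1, 0, 0, 0, 0, 1, 1, 2, 4, 10],
   [0, 0, 0, 0, 0, 0, 0, 0, 0, 0, 0, 1, 0, 0, 0, 0, 0, 1, 0, 3, 10],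
   [0, 0, 0, 0, 0, 0, 0, 0, 0, 0, 0, 0, 1, 0, 0, 1, 0, 2, 2, 6, 15],
   [0, 0, 0, 0, 0, 0, 0, 0, 0, 0, 0, 0, 0, 1, 1, 1, 2, 2, 4, 6, 12],
   [0, 0, 0, 0, 0, 0, 0, 0, 0, 0, 0, 0, 0, 0, 1, 2, 4, 6, 12, 24, 60],
   [0, 0, 0, 0, 0, 0, 0, 0, 0, 0, 0, 0, 0, 0, 0, 1, 0, 4, 4, 18, 60],
   [0, 0, 0, 0, 0, 0, 0, 0, 0, 0, 0, 0, 0, 0, 0, 0, 1, 1, 4, 9, 30],
   [0, 0, 0, 0, 0, 0, 0, 0, 0, 0, 0, 0, 0, 0, 0, 0, 0, 1, 0, 6, 30],
   [0, 0, 0, 0, 0, 0, 0, 0, 0, 0, 0, 0, 0, 0, 0, 0, 0, 0, 1, 3, 15],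
   [0, 0, 0, 0, 0, 0, 0, 0, 0, 0, 0, 0, 0, 0, 0, 0, 0, 0, 0, 1, 10],
   [0, 0, 0, 0, 0, 0, 0, 0, 0, 0, 0, 0, 0, 0, 0, 0, 0, 0, 0, 0, 1]]"

lemma
  assumes "M \<in> set patterns"
  shows verts_pattern: "verts M = {1..5}" and finite_simple_graph_pattern: "finite_simple_graph M"
proof -
  have "\<forall>M \<in> set patterns. verts M = {1..5} \<and> (\<forall>e \<in> edges M. e \<subseteq> {1..5} \<and> card e = 2)"
    by code_simp
  with assms show "verts M = {1..5}" "finite_simple_graph M"
    by (auto simp: finite_simple_graph_def)
qed

text \<open>A single statement, so that the costly edge vectors are evaluated only once.\<close>

lemma edge_vectors_patterns:
  "let Vs = map (\<lambda>F. edge_vectors F [1..<6]) patterns;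
       ts = map (\<lambda>T. edge_vector T [1..<6]) patterns in
   map (\<lambda>V. map (\<lambda>t. int (length (filter (\<lambda>v. list_all2 (\<longrightarrow>) v t) V))) ts) Vs = copy_counts \<and>
   (\<forall>M \<in> set patterns. \<forall>j \<in> set [1..<6]. \<forall>i \<in> set (filter (\<lambda>i. {i, j} \<notin> edges M) [1..<j]).
      \<exists>V \<in> set Vs. edge_vector ({1..5}, insert {i, j} (edges M)) [1..<6] \<in> set V)"
  by code_simp

lemma copy_counts_eq_noninduced_counts:
  "copy_counts = map (\<lambda>F. map (\<lambda>T. noninduced_count T F) patterns) patterns"
proof -
  have "noninduced_count T F = int (length (filter (\<lambda>v. list_all2 (\<longrightarrow>) v (edge_vector T [1..<6]))
      (edge_vectors F [1..<6])))" if "F \<in> set patterns" "T \<in> set patterns" for F T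
    using that by (intro noninduced_count_eq_length_filter_edge_vectors)
      (auto simp: verts_pattern finite_simple_graph_pattern)
  then show ?thesis
    unfolding edge_vectors_patterns[unfolded Let_def, THEN conjunct1, symmetric]
    by (simp add: comp_def)
qed

lemma distinct_copy_counts_columns:
  "distinct (map (\<lambda>i. map (\<lambda>row. row ! i) copy_counts) [0..<length patterns])"
  by code_simp

lemma distinct_noninduced_counts_patterns:
  "distinct (map (\<lambda>T. map (noninduced_count T) patterns) patterns)"
proof -
  have "map (\<lambda>T. map (noninduced_count T) patterns) patterns =
      map (\<lambda>i. map (\<lambda>row. row ! i) copy_counts) [0..<length patterns]"
    unfolding copy_counts_eq_noninduced_counts by (intro nth_equalityI) simp_all
  with distinct_copy_counts_columns show ?thesis by simp
qed

lemma graph_iso_patterns_imp_eq: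
  assumes "H \<in> set patterns" "K \<in> set patterns" "graph_iso H K"
  shows "H = K"
proof -
  have "noninduced_count H = (noninduced_count K :: nat graph \<Rightarrow> int)"
    using assms by (intro ext noninduced_count_eq_if_graph_iso finite_simple_graph_pattern)
  then have "map (noninduced_count H) patterns = map (noninduced_count K) patterns" by simp
  then show ?thesis
    using distinct_noninduced_counts_patterns assms(1,2)
    unfolding distinct_map inj_on_def by blast
qed

lemma insert_edge_closed_patterns: "insert_edge_closed (set patterns)"
  unfolding insert_edge_closed_def
proof (intro ballI allI impI)
  fix M e assume M: "M \<in> set patterns" and "e \<subseteq> verts M \<and> card e = 2"
  then have e: "e \<subseteq> {1..5}" "card e = 2" by (simp_all add: verts_pattern)
  show "\<exists>K \<in> set patterns. graph_iso (verts M, insert e (edges M)) K"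
  proof (cases "e \<in> edges M")
    case True
    with M graph_iso_refl[of M] show ?thesis by (metis insert_absorb prod.collapse)
  next
    case False
    from e(2) obtain i j where ij: "e = {i, j}" "i < j"
      by (metis card_2_iff insert_commute linorder_neqE_nat)
    with e(1) False have "j \<in> set [1..<6]" "i \<in> set (filter (\<lambda>i. {i, j} \<notin> edges M) [1..<j])"
      by auto
    then obtain K where K: "K \<in> set patterns"
      and "edge_vector ({1..5}, insert e (edges M)) [1..<6] \<in> set (edge_vectors K [1..<6])"
      using edge_vectors_patterns[unfolded Let_def, THEN conjunct2] M ij(1)
      unfolding list.set_map by blast
    moreover have "finite_simple_graph ({1..5}, insert e (edges M))"
      using finite_simple_graph_pattern[OF M] verts_pattern[OF M] e
      by (auto simp: finite_simple_graph_def)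
    ultimately have "graph_iso ({1..5}, insert e (edges M)) K"
      by (subst graph_iso_iff_edge_vector[where xs = "[1..<6]"])
         (auto simp: verts_pattern finite_simple_graph_pattern)
    with K M show ?thesis by (auto simp: verts_pattern)
  qed
qed

lemma noninduced_counts_eq_copy_counts_mult:
  assumes "finite_simple_graph G"
  shows "map (noninduced_count G) patterns =
    map (\<lambda>row. sum_list (map2 (*) row (map (induced_count G) patterns))) copy_counts"
proof -
  have "noninduced_count G F = (\<Sum>H \<leftarrow> patterns. noninduced_count H F * induced_count G H)"
    if "F \<in> set patterns" for F
  proof -
    have "noninduced_count G F = (\<Sum>H \<in> set patterns. noninduced_count H F * induced_count G H)"
      using assms insert_edge_closed_patterns graph_iso_patterns_imp_eq that
      by (intro noninduced_count_eq_sum_induced_count)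
         (auto simp: verts_pattern finite_simple_graph_pattern)
    moreover have "distinct patterns"
      using distinct_noninduced_counts_patterns by (simp add: distinct_map)
    ultimately show ?thesis by (simp add: sum_list_distinct_conv_sum_set)
  qed
  then show ?thesis
    unfolding copy_counts_eq_noninduced_counts by (simp add: map2_map_map)
qed

theorem theorem2:
  fixes G :: "'a graph"
  assumes "finite_simple_graph G"
  shows "(induced_count G M75 =
       noninduced_count G M75 - noninduced_count G M79 + noninduced_count G M95
       - noninduced_count G M127 - 2 * noninduced_count G M223 + noninduced_count G M235
       - noninduced_count G M239 + 2 * noninduced_count G M255 + noninduced_count G M507
       - 3 * noninduced_count G M511 + 5 * noninduced_count G M1023) \<and>
     (induced_count G M77 =
       noninduced_count G M77 - 2 * noninduced_count G M79 - 2 * noninduced_count G M87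
       - 2 * noninduced_count G M94 + 5 * noninduced_count G M95 - noninduced_count G M117
       + 4 * noninduced_count G M119 - 9 * noninduced_count G M127 + 6 * noninduced_count G M222
       - 12 * noninduced_count G M223 + 4 * noninduced_count G M235 + 4 * noninduced_count G M237
       - 10 * noninduced_count G M239 - 10 * noninduced_count G M254
       + 20 * noninduced_count G M255 + 20 * noninduced_count G M507
       - 36 * noninduced_count G M511 + 60 * noninduced_count G M1023) \<and>
     (induced_count G M79 =
       noninduced_count G M79 - 2 * noninduced_count G M95 + 3 * noninduced_count G M127
       + 6 * noninduced_count G M223 - 2 * noninduced_count G M235 + 3 * noninduced_count G M239
       - 8 * noninduced_count G M255 - 4 * noninduced_count G M507 + 15 * noninduced_count G M511
       - 30 * noninduced_count G M1023) \<and>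
     (induced_count G M86 =
       noninduced_count G M86 - noninduced_count G M87 - 2 * noninduced_count G M94
       + 2 * noninduced_count G M95 - 2 * noninduced_count G M117 + 4 * noninduced_count G M119
       - 6 * noninduced_count G M127 + 6 * noninduced_count G M222 - 6 * noninduced_count G M223
       + 4 * noninduced_count G M235 - 5 * noninduced_count G M236 + 7 * noninduced_count G M237
       - 10 * noninduced_count G M239 - 14 * noninduced_count G M254
       + 18 * noninduced_count G M255 + 24 * noninduced_count G M507
       - 36 * noninduced_count G M511 + 60 * noninduced_count G M1023) \<and>
     (induced_count G M87 =
       noninduced_count G M87 - 2 * noninduced_count G M95 - 2 * noninduced_count G M119
       + 6 * noninduced_count G M127 + 6 * noninduced_count G M223 - noninduced_count G M237
       + 5 * noninduced_count G M239 + 4 * noninduced_count G M254 - 14 * noninduced_count G M255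
       - 12 * noninduced_count G M507 + 30 * noninduced_count G M511
       - 60 * noninduced_count G M1023) \<and>
     (induced_count G M94 =
       noninduced_count G M94 - noninduced_count G M95 - noninduced_count G M119
       + 3 * noninduced_count G M127 - 6 * noninduced_count G M222 + 6 * noninduced_count G M223
       - 2 * noninduced_count G M237 + 4 * noninduced_count G M239 + 8 * noninduced_count G M254
       - 12 * noninduced_count G M255 - 16 * noninduced_count G M507
       + 30 * noninduced_count G M511 - 60 * noninduced_count G M1023) \<and>
     (induced_count G M95 =
       noninduced_count G M95 - 3 * noninduced_count G M127 - 6 * noninduced_count G M223
       - 2 * noninduced_count G M239 + 10 * noninduced_count G M255 + 4 * noninduced_count G M507
       - 24 * noninduced_count G M511 + 60 * noninduced_count G M1023) \<and>
     (induced_count G M117 =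
       noninduced_count G M117 - 2 * noninduced_count G M119 + 3 * noninduced_count G M127
       - 4 * noninduced_count G M235 - 2 * noninduced_count G M237 + 6 * noninduced_count G M239
       + 6 * noninduced_count G M254 - 12 * noninduced_count G M255 - 16 * noninduced_count G M507
       + 30 * noninduced_count G M511 - 60 * noninduced_count G M1023) \<and>
     (induced_count G M119 =
       noninduced_count G M119 - 3 * noninduced_count G M127 - 2 * noninduced_count G M239
       - 2 * noninduced_count G M254 + 8 * noninduced_count G M255 + 8 * noninduced_count G M507
       - 24 * noninduced_count G M511 + 60 * noninduced_count G M1023) \<and>
     (induced_count G M127 =
       noninduced_count G M127 - 2 * noninduced_count G M255 + 6 * noninduced_count G M511
       - 20 * noninduced_count G M1023) \<and>
     (induced_count G M222 =
       noninduced_count G M222 - noninduced_count G M223 - noninduced_count G M254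
       + noninduced_count G M255 + 2 * noninduced_count G M507 - 4 * noninduced_count G M511
       + 10 * noninduced_count G M1023) \<and>
     (induced_count G M223 =
       noninduced_count G M223 - noninduced_count G M255 + 3 * noninduced_count G M511
       - 10 * noninduced_count G M1023) \<and>
     (induced_count G M235 =
       noninduced_count G M235 - noninduced_count G M239 + 2 * noninduced_count G M255
       + 2 * noninduced_count G M507 - 6 * noninduced_count G M511 + 15 * noninduced_count G M1023) \<and>
     (induced_count G M236 =
       noninduced_count G M236 - noninduced_count G M237 + noninduced_count G M239
       + 2 * noninduced_count G M254 - 2 * noninduced_count G M255 - 4 * noninduced_count G M507
       + 6 * noninduced_count G M511 - 12 * noninduced_count G M1023) \<and>
     (induced_count G M237 =
       noninduced_count G M237 - 2 * noninduced_count G M239 - 4 * noninduced_count G M254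
       + 6 * noninduced_count G M255 + 12 * noninduced_count G M507 - 24 * noninduced_count G M511
       + 60 * noninduced_count G M1023) \<and>
     (induced_count G M239 =
       noninduced_count G M239 - 4 * noninduced_count G M255 - 4 * noninduced_count G M507
       + 18 * noninduced_count G M511 - 60 * noninduced_count G M1023) \<and>
     (induced_count G M254 =
       noninduced_count G M254 - noninduced_count G M255 - 4 * noninduced_count G M507
       + 9 * noninduced_count G M511 - 30 * noninduced_count G M1023) \<and>
     (induced_count G M255 =
       noninduced_count G M255 - 6 * noninduced_count G M511 + 30 * noninduced_count G M1023) \<and>
     (induced_count G M507 =
       noninduced_count G M507 - 3 * noninduced_count G M511 + 15 * noninduced_count G M1023) \<and>
     (induced_count G M511 =
       noninduced_count G M511 - 10 * noninduced_count G M1023) \<and>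
     (induced_count G M1023 =
       noninduced_count G M1023)"
proof -
  have "map (noninduced_count G) patterns =
      map (\<lambda>row. sum_list (map2 (*) row (map (induced_count G) patterns))) copy_counts"
    using assms by (rule noninduced_counts_eq_copy_counts_mult)
  then show ?thesis
    by (simp add: patterns_def copy_counts_def)
qed

end
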